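(* Let $m,d,s\geq 1$ and $A,B\geq 0$ be integers. If $A+B=\binom{m+d}{d}$, then $$A_{(m)}|_0^{s}+B_{(d)}|_s^{s}=\binom{m+d+s}{d+s}.$$
   Context: Macaulay representation: for positive integers $A$ and $n$ there exist a unique integer $\delta$ with $1\le\delta\le n$ and unique integers $a_n>a_{n-1}>\cdots>a_\delta>0$ with $a_j\ge j$ for every $j$ such that $A=\binom{a_n}{n}+\binom{a_{n-1}}{n-1}+\cdots+\binom{a_\delta}{\delta}$; this is the $n$-th Macaulay representation of $A$, denoted $A_{(n)}$. For integers $\sigma,\tau$ define $A_{(n)}|_\sigma^\tau=\binom{a_n+\tau}{n+\sigma}+\cdots+\binom{a_\delta+\tau}{\delta+\sigma}$ (the lower index shifts the bottom entries, the upper index shifts the top entries). Convention: $0_{(n)}|_\sigma^\tau=0$. *)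

theory Defs
  imports Main
begin

text \<open>
  The coefficients of an \<open>n\<close>-th Macaulay representation of \<open>A\<close>, starting at index \<open>\<delta>\<close>. Only
  \<open>a \<delta>, \<dots>, a n\<close> matter; the remaining values are normalised to \<open>0\<close> so that the pair \<open>(\<delta>, a)\<close>
  is unique.
\<close>

definition is_macaulay_rep :: "nat \<Rightarrow> nat \<Rightarrow> nat \<Rightarrow> (nat \<Rightarrow> nat) \<Rightarrow> bool" where
  "is_macaulay_rep n A \<delta> a \<longleftrightarrow>
     1 \<le> \<delta> \<and> \<delta> \<le> n \<and>
     strict_mono_on {\<delta>..n} a \<and> 0 < a \<delta> \<and>
     (\<forall>j\<in>{\<delta>..n}. j \<le> a j) \<and>
     (\<forall>j. j \<notin> {\<delta>..n} \<longrightarrow> a j = 0) \<and>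
     A = (\<Sum>j=\<delta>..n. a j choose j)"

definition macaulay_rep :: "nat \<Rightarrow> nat \<Rightarrow> nat \<times> (nat \<Rightarrow> nat)" where
  "macaulay_rep n A = (THE (\<delta>, a). is_macaulay_rep n A \<delta> a)"

text \<open>
  Shifted entries may be negative integers; a binomial coefficient with a negative entry is taken
  to be \<open>0\<close>. For nonnegative entries this is the usual one, which vanishes when the bottom entry
  exceeds the top.
\<close>

definition int_choose :: "int \<Rightarrow> int \<Rightarrow> nat" where
  "int_choose x k = (if 0 \<le> x \<and> 0 \<le> k then nat x choose nat k else 0)"

text \<open>
  \<open>macaulay_shift n A \<sigma> \<tau>\<close> is $A_{(n)}|_\sigma^\tau$: \<open>\<sigma>\<close> is added to the bottom entries, \<open>\<tau>\<close> to the
  top entries.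
\<close>

definition macaulay_shift :: "nat \<Rightarrow> nat \<Rightarrow> int \<Rightarrow> int \<Rightarrow> nat" where
  "macaulay_shift n A \<sigma> \<tau> =
     (if A = 0 then 0
      else let (\<delta>, a) = macaulay_rep n A
           in \<Sum>j=\<delta>..n. int_choose (int (a j) + \<tau>) (int j + \<sigma>))"

text \<open>Existence and uniqueness, which justify the definite description above.\<close>

lemma is_macaulay_rep_Suc:
  assumes "is_macaulay_rep (Suc n) A \<delta> a" "\<delta> \<noteq> Suc n"
  shows "is_macaulay_rep n (A - (a (Suc n) choose Suc n)) \<delta> (a(Suc n := 0))"
    and "a n < a (Suc n)" and "\<delta> \<le> n"
proof -
  have d: "1 \<le> \<delta>" "\<delta> \<le> n" using assms by (auto simp: is_macaulay_rep_def)
  have mono: "strict_mono_on {\<delta>..Suc n} a" using assms by (auto simp: is_macaulay_rep_def)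
  show "\<delta> \<le> n" by fact
  show "a n < a (Suc n)" using mono d by (auto simp: strict_mono_on_def)
  have "(\<Sum>j=\<delta>..n. (a(Suc n := 0)) j choose j) = (\<Sum>j=\<delta>..n. a j choose j)"
    by (intro sum.cong) auto
  moreover have "strict_mono_on {\<delta>..n} (a(Suc n := 0))"
    using mono by (auto simp: strict_mono_on_def)
  ultimately show "is_macaulay_rep n (A - (a (Suc n) choose Suc n)) \<delta> (a(Suc n := 0))"
    using assms(1) d by (auto simp: is_macaulay_rep_def)
qed

lemma is_macaulay_rep_bounds:
  assumes "is_macaulay_rep n A \<delta> a"
  shows "a n choose n \<le> A" "A < Suc (a n) choose n"
proof -
  have "(a n choose n \<le> A) \<and> A < Suc (a n) choose n"
    using assms
  proof (induction n arbitrary: A a)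
    case 0
    then show ?case by (auto simp: is_macaulay_rep_def)
  next
    case (Suc n)
    have le: "Suc n \<le> a (Suc n)" using Suc.prems by (auto simp: is_macaulay_rep_def)
    have A: "A = (\<Sum>j=\<delta>..Suc n. a j choose j)" and d: "\<delta> \<le> Suc n"
      using Suc.prems by (auto simp: is_macaulay_rep_def)
    then have low: "a (Suc n) choose Suc n \<le> A" by simp
    show ?case
    proof (cases "\<delta> = Suc n")
      case True
      then show ?thesis using A le by auto
    next
      case False
      note r = is_macaulay_rep_Suc[OF Suc.prems False]
      have "A - (a (Suc n) choose Suc n) < Suc ((a(Suc n := 0)) n) choose n"
        using Suc.IH[OF r(1)] by blast
      also have "\<dots> \<le> a (Suc n) choose n"
        using r(2) by (auto intro!: binomial_right_mono)
      finally show ?thesis using low by auto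
    qed
  qed
  then show "a n choose n \<le> A" "A < Suc (a n) choose n" by auto
qed

lemma is_macaulay_rep_unique:
  assumes "is_macaulay_rep n A \<delta> a" "is_macaulay_rep n A \<epsilon> b"
  shows "\<delta> = \<epsilon> \<and> a = b"
  using assms
proof (induction n arbitrary: A a b)
  case 0
  then show ?case by (auto simp: is_macaulay_rep_def)
next
  case (Suc n)
  have top: "a (Suc n) = b (Suc n)"
  proof (rule ccontr)
    assume "a (Suc n) \<noteq> b (Suc n)"
    then consider "Suc (a (Suc n)) \<le> b (Suc n)" | "Suc (b (Suc n)) \<le> a (Suc n)" by linarith
    then show False
    proof cases
      case 1
      then have "Suc (a (Suc n)) choose Suc n \<le> b (Suc n) choose Suc n" by (rule binomial_right_mono)
      then show False
        using is_macaulay_rep_bounds[OF Suc.prems(1)] is_macaulay_rep_bounds[OF Suc.prems(2)]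
        by linarith
    next
      case 2
      then have "Suc (b (Suc n)) choose Suc n \<le> a (Suc n) choose Suc n" by (rule binomial_right_mono)
      then show False
        using is_macaulay_rep_bounds[OF Suc.prems(1)] is_macaulay_rep_bounds[OF Suc.prems(2)]
        by linarith
    qed
  qed
  have pos: "0 < B" if "is_macaulay_rep n B \<gamma> c" for B \<gamma> c
  proof -
    have "n \<le> c n" using that by (auto simp: is_macaulay_rep_def)
    then have "0 < c n choose n" by simp
    then show ?thesis using is_macaulay_rep_bounds(1)[OF that] by linarith
  qed
  have single: "A = (c (Suc n) choose Suc n)"
    if "is_macaulay_rep (Suc n) A (Suc n) c" for c
    using that by (auto simp: is_macaulay_rep_def)
  show ?case
  proof (cases "\<delta> = Suc n")
    case True
    have e: "\<epsilon> = Suc n"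
    proof (rule ccontr)
      assume "\<epsilon> \<noteq> Suc n"
      from pos[OF is_macaulay_rep_Suc(1)[OF Suc.prems(2) this]]
      show False using single[of a] Suc.prems(1) True top by auto
    qed
    have "a j = b j" for j
      using Suc.prems True e top by (cases "j = Suc n") (auto simp: is_macaulay_rep_def)
    then show ?thesis using True e by auto
  next
    case False
    have e: "\<epsilon> \<noteq> Suc n"
    proof
      assume "\<epsilon> = Suc n"
      with pos[OF is_macaulay_rep_Suc(1)[OF Suc.prems(1) False]]
      show False using single[of b] Suc.prems(2) top by auto
    qed
    have *: "\<delta> = \<epsilon> \<and> a(Suc n := 0) = b(Suc n := 0)"
      by (rule Suc.IH[OF is_macaulay_rep_Suc(1)[OF Suc.prems(1) False]
            is_macaulay_rep_Suc(1)[OF Suc.prems(2) e, folded top]])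
    moreover have "a = b"
      using * top by (metis fun_upd_triv fun_upd_upd)
    ultimately show ?thesis by blast
  qed
qed

lemma is_macaulay_rep_exists:
  assumes "1 \<le> n" "1 \<le> A"
  shows "\<exists>\<delta> a. is_macaulay_rep n A \<delta> a"
  using assms
proof (induction n arbitrary: A)
  case 0
  then show ?case by simp
next
  case (Suc n)
  define t where "t = (GREATEST x. x choose Suc n \<le> A)"
  have bound: "x \<le> A + n" if "x choose Suc n \<le> A" for x
  proof (rule ccontr)
    assume "\<not> x \<le> A + n"
    then have "Suc (A + n) choose Suc n \<le> x choose Suc n" by (intro binomial_right_mono) simp
    moreover have "A < Suc (A + n) choose Suc n"
    proof (induction A)
      case (Suc A)
      have "0 < Suc (A + n) choose n" by simp
      moreover have "Suc (Suc A + n) choose Suc n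
          = (Suc (A + n) choose n) + (Suc (A + n) choose Suc n)"
        by (metis add_Suc binomial_Suc_Suc)
      ultimately show ?case using Suc by linarith
    qed simp
    ultimately show False using that by linarith
  qed
  have t: "t choose Suc n \<le> A"
    unfolding t_def by (rule GreatestI_nat[where k = 0]) (use bound in auto)
  have t_max: "x \<le> t" if "x choose Suc n \<le> A" for x
    unfolding t_def by (rule Greatest_le_nat) (use bound that in auto)
  have tn: "Suc n \<le> t" using Suc.prems by (intro t_max) simp
  have At: "A < Suc t choose Suc n"
    using t_max[of "Suc t"] by (meson not_less Suc_n_not_le_n)
  show ?case
  proof (cases "A = (t choose Suc n)")
    case True
    have "is_macaulay_rep (Suc n) A (Suc n) ((\<lambda>_. 0)(Suc n := t))"
      using True tn by (auto simp: is_macaulay_rep_def strict_mono_on_def)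
    then show ?thesis by blast
  next
    case False
    define B where "B = A - (t choose Suc n)"
    have B: "1 \<le> B" "B < t choose n" "A = B + (t choose Suc n)"
      using False t At by (auto simp: B_def)
    have n: "1 \<le> n" using B by (cases n) auto
    obtain \<delta> a where r: "is_macaulay_rep n B \<delta> a" using Suc.IH[OF n B(1)] by blast
    have "a n < t"
    proof (rule ccontr)
      assume "\<not> a n < t"
      then have "t choose n \<le> a n choose n" by (intro binomial_right_mono) simp
      then show False using is_macaulay_rep_bounds(1)[OF r] B by linarith
    qed
    have d: "1 \<le> \<delta>" "\<delta> \<le> n" and mono: "strict_mono_on {\<delta>..n} a"
      using r by (auto simp: is_macaulay_rep_def)
    have lt: "a j < t" if "j \<in> {\<delta>..n}" for j
    proof -
      have "a j \<le> a n"
        using that mono d by (cases "j = n") (auto simp: strict_mono_on_def intro: less_imp_le)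
      then show ?thesis using \<open>a n < t\<close> by linarith
    qed
    have "strict_mono_on {\<delta>..Suc n} (a(Suc n := t))"
      using mono lt by (auto simp: strict_mono_on_def le_Suc_eq)
    moreover have "(\<Sum>j=\<delta>..n. (a(Suc n := t)) j choose j) = (\<Sum>j=\<delta>..n. a j choose j)"
      by (intro sum.cong) auto
    ultimately have "is_macaulay_rep (Suc n) A \<delta> (a(Suc n := t))"
      using r d tn B(3) by (auto simp: is_macaulay_rep_def le_Suc_eq)
    then show ?thesis by blast
  qed
qed

lemma macaulay_rep_eqI:
  assumes "is_macaulay_rep n A \<delta> a"
  shows "macaulay_rep n A = (\<delta>, a)"
  unfolding macaulay_rep_def
  using assms by (intro the_equality) (auto dest: is_macaulay_rep_unique)

lemma is_macaulay_rep_macaulay_rep: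
  assumes "1 \<le> n" "1 \<le> A"
  shows "case macaulay_rep n A of (\<delta>, a) \<Rightarrow> is_macaulay_rep n A \<delta> a"
  using is_macaulay_rep_exists[OF assms] by (auto simp: macaulay_rep_eqI)

end

theory Submission
  imports Defs
begin

text \<open>
  Induction on \<open>m + d\<close>. If neither \<open>A\<close> nor \<open>B\<close> vanishes, Pascal's rule
  $\binom{m+d}{d} = \binom{m+d-1}{m} + \binom{m+d-1}{d}$ forces $A \ge \binom{m+d-1}{m}$ or
  $B \ge \binom{m+d-1}{d}$. The corresponding leading Macaulay coefficient is then \<open>m + d - 1\<close>;
  removing that leading term lowers \<open>m\<close> or \<open>d\<close> by one and leaves the other summand unchanged,
  and Pascal's rule for the shifted binomials closes the induction.
\<close>

lemma int_choose_of_nat [simp]: "int_choose (int x) (int k) = x choose k"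
  by (simp add: int_choose_def)

lemma macaulay_shift_0 [simp]: "macaulay_shift n 0 \<sigma> \<tau> = 0"
  by (simp add: macaulay_shift_def)

lemma macaulay_shift_rep:
  assumes "is_macaulay_rep n A \<delta> a" "0 < A"
  shows "macaulay_shift n A \<sigma> \<tau> = (\<Sum>j=\<delta>..n. int_choose (int (a j) + \<tau>) (int j + \<sigma>))"
  using assms(2) by (simp add: macaulay_shift_def macaulay_rep_eqI[OF assms(1)])

text \<open>By Pascal's rule the bound on \<open>B\<close> places the sum in the interval from
  \<open>t choose Suc n\<close> up to, but excluding, \<open>Suc t choose Suc n\<close>, which
  forces the leading coefficient to be \<open>t\<close>. Deleting it leaves the representation of
  \<open>B\<close>.\<close>

lemma macaulay_shift_leading_term:
  assumes "Suc n \<le> t" "B < t choose n"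
  shows "macaulay_shift (Suc n) ((t choose Suc n) + B) \<sigma> \<tau> =
    int_choose (int t + \<tau>) (int (Suc n) + \<sigma>) + macaulay_shift n B \<sigma> \<tau>"
proof -
  define A where "A = (t choose Suc n) + B"
  have A: "0 < A" using assms(1) by (simp add: A_def)
  then obtain \<delta> a where r: "is_macaulay_rep (Suc n) A \<delta> a"
    using is_macaulay_rep_exists[of "Suc n" A] by auto
  have At: "A < Suc t choose Suc n" using assms(2) by (simp add: A_def)
  note bounds = is_macaulay_rep_bounds[OF r]
  have "\<not> Suc t \<le> a (Suc n)"
    using binomial_right_mono[of "Suc t" "a (Suc n)" "Suc n"] bounds(1) At by linarith
  moreover have "\<not> Suc (a (Suc n)) \<le> t"
    using binomial_right_mono[of "Suc (a (Suc n))" t "Suc n"] bounds(2)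
    by (auto simp: A_def simp del: binomial_Suc_Suc)
  ultimately have top: "a (Suc n) = t" by linarith
  have shift: "macaulay_shift (Suc n) A \<sigma> \<tau> =
      (\<Sum>j=\<delta>..Suc n. int_choose (int (a j) + \<tau>) (int j + \<sigma>))"
    by (rule macaulay_shift_rep[OF r A])
  show ?thesis
  proof (cases "\<delta> = Suc n")
    case True
    \<comment> \<open>A representation with a single term leaves no remainder, and the shift of 0 is
      0 by convention.\<close>
    then have "B = 0" using r top by (auto simp: is_macaulay_rep_def A_def)
    then show ?thesis using shift True top by (simp add: A_def)
  next
    case False
    note rest = is_macaulay_rep_Suc[OF r False]
    have rB: "is_macaulay_rep n B \<delta> (a(Suc n := 0))"
      using rest(1) by (simp add: top A_def)
    \<comment> \<open>The shift of \<open>B\<close> is read off its representation only for nonzero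
      \<open>B\<close>; a leading top entry of at least \<open>n\<close> ensures this.\<close>
    have "n \<le> (a(Suc n := 0)) n" using rB by (auto simp: is_macaulay_rep_def)
    then have "0 < (a(Suc n := 0)) n choose n" by simp
    then have "0 < B" using is_macaulay_rep_bounds(1)[OF rB] by linarith
    then have "macaulay_shift n B \<sigma> \<tau> =
        (\<Sum>j=\<delta>..n. int_choose (int ((a(Suc n := 0)) j) + \<tau>) (int j + \<sigma>))"
      by (rule macaulay_shift_rep[OF rB])
    also have "\<dots> = (\<Sum>j=\<delta>..n. int_choose (int (a j) + \<tau>) (int j + \<sigma>))"
      by (intro sum.cong) auto
    finally show ?thesis using shift rest(3) top by (simp add: A_def)
  qed
qed

text \<open>A single binomial coefficient is its own Macaulay representation: the leading-term
  recursion with remainder 0.\<close>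

lemma macaulay_shift_binomial:
  assumes "1 \<le> n" "n \<le> t"
  shows "macaulay_shift n (t choose n) \<sigma> \<tau> = int_choose (int t + \<tau>) (int n + \<sigma>)"
  using macaulay_shift_leading_term[of "n - 1" t 0 \<sigma> \<tau>] assms by (cases n) auto

text \<open>The degenerate cases \<open>m = 0\<close> and \<open>d = 0\<close> are admitted so that the induction can pass through them.\<close>

lemma macaulay_shift_complementary:
  assumes "A + B = (m + d) choose d" "0 < A \<longrightarrow> 0 < m" "0 < B \<longrightarrow> 0 < d"
  shows "macaulay_shift m A 0 (int s) + macaulay_shift d B (int s) (int s)
           = (m + d + s) choose (d + s)"
  using assms
proof (induction "m + d" arbitrary: m d A B)
  case 0
  then show ?case by simp
next
  case (Suc k)
  have choose_sym: "(x + y) choose x = (x + y) choose y" for x y :: nat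
    using binomial_symmetric[of x "x + y"] by simp
  have pos: "0 < A + B" using Suc.prems(1) by simp
  consider "A = 0" | "B = 0" | "0 < A" "0 < B" by blast
  then show ?case
  proof cases
    case 1
    then have "0 < d" using Suc.prems pos by simp
    with 1 Suc.prems show ?thesis
      using macaulay_shift_binomial[of d "m + d" "int s" "int s"] by (simp flip: of_nat_add)
  next
    case 2
    then have "0 < m" using Suc.prems pos by simp
    \<comment> \<open>Symmetry turns \<open>A\<close> into \<open>(m + d) choose m\<close>, a
      one-term \<open>m\<close>-th representation.\<close>
    with 2 Suc.prems show ?thesis
      using macaulay_shift_binomial[of m "m + d" 0 "int s"] choose_sym[of m d]
        choose_sym[of m "d + s"] by (simp add: add.assoc flip: of_nat_add)
  next
    case 3
    then obtain m' d' where m: "m = Suc m'" and d: "d = Suc d'"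
      using Suc.prems by (meson gr0_implies_Suc)
    have k: "k = m' + Suc d'" "k = Suc m' + d'" using Suc.hyps m d by auto
    have sum: "A + B = (k choose d') + (k choose d)"
      using Suc.prems(1) m d k by simp
    have sym: "k choose m' = k choose d" "k choose m = k choose d'"
      using choose_sym[of m' "Suc d'"] choose_sym[of "Suc m'" d'] m d k by auto
    have sym_s: "(k + s) choose m = (k + s) choose (d' + s)"
      using choose_sym[of m "d' + s"] m k by (simp add: add.assoc)
    have pascal: "(m + d + s) choose (d + s)
        = ((k + s) choose (d' + s)) + ((k + s) choose (d + s))"
      using m d k by simp
    consider "k choose m \<le> A" | "k choose d \<le> B" using sum sym by linarith
    then show ?thesis
    proof cases
      case 1
      define A' where "A' = A - (k choose m)"
      have A: "A = (k choose Suc m') + A'" using 1 m by (simp add: A'_def)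
      have A': "A' + B = k choose d" using sum sym 1 by (simp add: A'_def)
      \<comment> \<open>Strict because \<open>B\<close> is positive; for \<open>m' = 0\<close> the
        bound is 1, so \<open>A'\<close> vanishes, as the induction hypothesis demands.\<close>
      then have lt: "A' < k choose m'" using 3 sym by linarith
      then have "0 < A' \<longrightarrow> 0 < m'" by (cases m') auto
      then have "macaulay_shift m' A' 0 (int s) + macaulay_shift d B (int s) (int s)
          = (m' + d + s) choose (d + s)"
        using Suc.hyps(1)[of m' d A' B] A' k d by simp
      moreover have "macaulay_shift m A 0 (int s)
          = ((k + s) choose m) + macaulay_shift m' A' 0 (int s)"
        using macaulay_shift_leading_term[of m' k A' 0 "int s"] lt k m A
        by (simp flip: of_nat_add of_nat_Suc)
      \<comment> \<open>The leading term of \<open>A\<close> gives the first Pascal summand, by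
        symmetry, and the induction hypothesis the second.\<close>
      ultimately show ?thesis using pascal sym_s k d by simp
    next
      case 2
      define B' where "B' = B - (k choose d)"
      have B: "B = (k choose Suc d') + B'" using 2 d by (simp add: B'_def)
      have B': "A + B' = k choose d'" using sum 2 by (simp add: B'_def)
      then have lt: "B' < k choose d'" using 3 by linarith
      then have "0 < B' \<longrightarrow> 0 < d'" by (cases d') auto
      then have "macaulay_shift m A 0 (int s) + macaulay_shift d' B' (int s) (int s)
          = (m + d' + s) choose (d' + s)"
        using Suc.hyps(1)[of m d' A B'] B' k m by simp
      moreover have "macaulay_shift d B (int s) (int s)
          = ((k + s) choose (d + s)) + macaulay_shift d' B' (int s) (int s)"
        using macaulay_shift_leading_term[of d' k B' "int s" "int s"] lt k d B
        by (simp flip: of_nat_add of_nat_Suc)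
      \<comment> \<open>Here the roles of the two Pascal summands are exchanged.\<close>
      ultimately show ?thesis using pascal k m by simp
    qed
  qed
qed

theorem lemma2p1:
  fixes m d s A B :: nat
  assumes "m \<ge> 1" and "d \<ge> 1" and "s \<ge> 1"
    and "A + B = (m + d) choose d"
  shows "macaulay_shift m A 0 (int s) + macaulay_shift d B (int s) (int s)
           = (m + d + s) choose (d + s)"
  using macaulay_shift_complementary assms by simp

end
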